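(* Let $w$ be a weight vector, let $m\in S=\mathbb{K}[x_1,\dots,x_n]$ be a monomial, and let $d=\deg_w(m)$. Then for all $d\le a\le d+\max(w)-1$ and $1\le b\le n$, $$C_{w,m}(a,b)=q_b^a(\overline{m}),$$ where $\max(w)=\max_i w_i=w_1$.
   Context: Let $\mathbb{K}$ be a field, $S=\mathbb{K}[x_1,\dots,x_n]$, $R=\mathbb{K}[y_1,\dots,y_n]$. A weight vector is $w=(w_1,\dots,w_n)$ of positive integers with $w_1\ge w_2\ge\dots\ge w_n$. Write $\deg_w(x_1^{a_1}\cdots x_n^{a_n})=\sum_i w_ia_i$; all degrees in $S$ are with respect to $\deg_w$. Let $\psi:S\to R$ be the $\mathbb{K}$-algebra homomorphism with $\psi(x_i)=y_i^{w_i}$. A Borel move on a monomial $m\in R$ sends $m$ to $m\cdot\frac{y_{i_1}}{y_{j_1}}\cdots\frac{y_{i_s}}{y_{j_s}}$, where $i_t<j_t$ for all $t$ and $y_{j_1}\cdots y_{j_s}$ divides $m$. A monomial ideal of $R$ is strongly stable if it is closed under Borel moves on its monomials. $Borel(\mu)$ is the smallest strongly stable ideal of $R$ containing the monomial $\mu$. For a monomial $m\in S$, $\overline{m}:=\psi^{-1}(Borel(\psi(m)))$. For a monomial $\mu=y_{i_1}\cdots y_{i_r}$ with $i_1\le\dots\le i_r$ and an integer $e\ge 0$, $trunc_e(\mu)=y_{i_1}\cdots y_{i_e}$ if $e\le r$, and $trunc_e(\mu)=\mu$ if $e>r$. For a monomial $\mu$, $\max(\mu)$ is the largest index of a variable dividing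 $\mu$, with $\max(1)=1$. The weighted Catalan diagram $C_{w,m}$, with $d=\deg_w(m)$, is the array of nonnegative integers $C_{w,m}(a,b)$, $0\le a\le d+w_1-1$, $1\le b\le n$, defined by $C_{w,m}(0,1)=1$ and, for all other $(a,b)$, $C_{w,m}(a,b)=\sum_{k=1}^b C_{w,m}(a-w_b,k)$ if $0\le a-w_b<d$ and $\max(trunc_{a-w_b+1}(\psi(m)))\ge b$, and $C_{w,m}(a,b)=0$ otherwise. For a monomial ideal $I\subset S$ with set of minimal monomial generators $G(I)$, $q_i^e(I)$ is the number of $g\in G(I)$ with $\max(g)=i$ and $\deg_w(g)=e$. *)

theory Defs
  imports "HOL-Library.Poly_Mapping" "HOL-Algebra.Ideal"
begin

section \<open>Monomials and polynomial rings\<close>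

text \<open>
  A monomial is represented by its exponent vector, so multiplication of monomials is addition of
  exponent vectors and the monomial 1 is the zero vector. Variables are indexed by natural numbers,
  and \<^term>\<open>polyring n\<close> consists of the polynomials that involve only the variables 1, ..., n.
  It serves both as the ring S in the variables x and as the ring R in the variables y.
\<close>

type_synonym monomial = "nat \<Rightarrow>\<^sub>0 nat"
type_synonym 'k mpoly = "monomial \<Rightarrow>\<^sub>0 'k"

definition monomials :: "nat \<Rightarrow> monomial set" where
  "monomials n = {t. Poly_Mapping.keys t \<subseteq> {1..n}}"

definition monom_poly :: "monomial \<Rightarrow> 'k::field mpoly" where
  "monom_poly t = Poly_Mapping.single t 1"

definition const :: "'k::field \<Rightarrow> 'k mpoly" where
  "const c = Poly_Mapping.single 0 c"

definition varm :: "nat \<Rightarrow> monomial" where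
  "varm i = Poly_Mapping.single i 1"

definition polyring :: "nat \<Rightarrow> 'k::field mpoly ring" where
  "polyring n = \<lparr>carrier = {p. Poly_Mapping.keys p \<subseteq> monomials n}, mult = (*), one = 1, zero = 0, add = (+)\<rparr>"

definition monomial_ideal :: "nat \<Rightarrow> 'k::field mpoly set \<Rightarrow> bool" where
  "monomial_ideal n I \<longleftrightarrow> (\<exists>M \<subseteq> monomials n. I = genideal (polyring n) (monom_poly ` M))"

definition generates :: "nat \<Rightarrow> monomial set \<Rightarrow> 'k::field mpoly set \<Rightarrow> bool" where
  "generates n M I \<longleftrightarrow> M \<subseteq> monomials n \<and> genideal (polyring n) (monom_poly ` M) = I"

text \<open>
  The definite description is justified by \<open>minimal_generators_eq\<close> below: a monomial ideal has
  exactly one inclusion-minimal set of monomial generators.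
\<close>

definition min_gens :: "nat \<Rightarrow> 'k::field mpoly set \<Rightarrow> monomial set" where
  "min_gens n I = (THE M. generates n M I \<and> (\<forall>M'. M' \<subset> M \<longrightarrow> \<not> generates n M' I))"

definition max_index :: "monomial \<Rightarrow> nat" where
  "max_index t = (if t = 0 then 1 else Max (Poly_Mapping.keys t))"


section \<open>Weights\<close>

definition weight_vector :: "nat \<Rightarrow> (nat \<Rightarrow> nat) \<Rightarrow> bool" where
  "weight_vector n w \<longleftrightarrow>
     (\<forall>i\<in>{1..n}. 0 < w i) \<and> (\<forall>i\<in>{1..n}. \<forall>j\<in>{1..n}. i \<le> j \<longrightarrow> w j \<le> w i)"

definition wdeg :: "(nat \<Rightarrow> nat) \<Rightarrow> monomial \<Rightarrow> nat" where
  "wdeg w t = (\<Sum>i\<in>Poly_Mapping.keys t. w i * Poly_Mapping.lookup t i)"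

definition psi :: "(nat \<Rightarrow> nat) \<Rightarrow> 'k::field mpoly \<Rightarrow> 'k mpoly" where
  "psi w p = (\<Sum>t\<in>Poly_Mapping.keys p. const (Poly_Mapping.lookup p t) *
      (\<Prod>i\<in>Poly_Mapping.keys t. (monom_poly (varm i) ^ w i) ^ Poly_Mapping.lookup t i))"

text \<open>The exponent vector of the image of a monomial under \<^const>\<open>psi\<close>, see \<open>psi_mon\<close> below.\<close>

definition psi_exp :: "(nat \<Rightarrow> nat) \<Rightarrow> monomial \<Rightarrow> monomial" where
  "psi_exp w t = Poly_Mapping.mapp (\<lambda>i a. w i * a) t"

definition qcount :: "nat \<Rightarrow> (nat \<Rightarrow> nat) \<Rightarrow> nat \<Rightarrow> nat \<Rightarrow> 'k::field mpoly set \<Rightarrow> nat" where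
  "qcount n w i e I = card {g \<in> min_gens n I. max_index g = i \<and> wdeg w g = e}"


section \<open>Strongly stable ideals\<close>

text \<open>
  A list of pairs (i, j) encodes the exchanges of a Borel move. Divisibility of the monomial by the
  product of the variables with index j is expressed through the cofactor c.
\<close>

definition borel_move :: "nat \<Rightarrow> monomial \<Rightarrow> monomial \<Rightarrow> bool" where
  "borel_move n t u \<longleftrightarrow>
     (\<exists>ps c. (\<forall>(i, j)\<in>set ps. 1 \<le> i \<and> i < j \<and> j \<le> n) \<and>
        t = c + (\<Sum>(i, j)\<leftarrow>ps. varm j) \<and>
        u = c + (\<Sum>(i, j)\<leftarrow>ps. varm i))"

definition strongly_stable :: "nat \<Rightarrow> 'k::field mpoly set \<Rightarrow> bool" where
  "strongly_stable n I \<longleftrightarrow> monomial_ideal n I \<and>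
     (\<forall>t\<in>monomials n. \<forall>u. monom_poly t \<in> I \<longrightarrow> borel_move n t u \<longrightarrow> monom_poly u \<in> I)"

definition Borel :: "nat \<Rightarrow> 'k::field mpoly \<Rightarrow> 'k mpoly set" where
  "Borel n \<mu> = \<Inter>{I. strongly_stable n I \<and> \<mu> \<in> I}"

definition weighted_closure :: "nat \<Rightarrow> (nat \<Rightarrow> nat) \<Rightarrow> monomial \<Rightarrow> 'k::field mpoly set" where
  "weighted_closure n w m = {p \<in> carrier (polyring n). psi w p \<in> Borel n (psi w (monom_poly m))}"


section \<open>The weighted Catalan diagram\<close>

definition mono_word :: "monomial \<Rightarrow> nat list" where
  "mono_word t =
     concat (map (\<lambda>i. replicate (Poly_Mapping.lookup t i) i) (sorted_list_of_set (Poly_Mapping.keys t)))"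

definition trunc :: "nat \<Rightarrow> monomial \<Rightarrow> monomial" where
  "trunc e t = (\<Sum>i\<leftarrow>take e (mono_word t). varm i)"

text \<open>
  The condition \<open>0 < w b\<close> holds for weight vectors and is only there to make the recursion
  terminate for arbitrary w.
\<close>

function catalan :: "(nat \<Rightarrow> nat) \<Rightarrow> monomial \<Rightarrow> nat \<Rightarrow> nat \<Rightarrow> nat" where
  "catalan w m a b =
     (if a = 0 \<and> b = 1 then 1
      else if 0 < w b \<and> w b \<le> a \<and> a - w b < wdeg w m \<and>
              b \<le> max_index (trunc (a - w b + 1) (psi_exp w m))
      then \<Sum>k = 1..b. catalan w m (a - w b) k
      else 0)"
  by pat_completeness auto
termination
  by (relation "measure (\<lambda>(w, m, a, b). a)") auto

declare catalan.simps [simp del]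


section \<open>Adequacy of the definitions\<close>

lemma polyring_simps [simp]:
  "carrier (polyring n) = {p. Poly_Mapping.keys p \<subseteq> monomials n}"
  "mult (polyring n) = (*)" "one (polyring n) = 1"
  "zero (polyring n) = 0" "add (polyring n) = (+)"
  by (simp_all add: polyring_def)

lemma monomials_add: "s + t \<in> monomials n \<longleftrightarrow> s \<in> monomials n \<and> t \<in> monomials n"
proof -
  have "Poly_Mapping.keys (s + t) = Poly_Mapping.keys s \<union> Poly_Mapping.keys t"
    by (auto simp: in_keys_iff lookup_add)
  then show ?thesis by (auto simp: monomials_def)
qed

lemma polyring_cring: "cring (polyring n :: 'k::field mpoly ring)"
proof (rule cringI)
  show "abelian_group (polyring n :: 'k mpoly ring)"
  proof (rule abelian_groupI)
    fix x y :: "'k mpoly"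
    assume "x \<in> carrier (polyring n)" "y \<in> carrier (polyring n)"
    then show "x \<oplus>\<^bsub>polyring n\<^esub> y \<in> carrier (polyring n)"
      using keys_add[of x y] by auto
  next
    fix x :: "'k mpoly"
    assume "x \<in> carrier (polyring n)"
    then have "- x \<in> carrier (polyring n)" "- x + x = 0"
      by (auto simp: in_keys_iff)
    then show "\<exists>y\<in>carrier (polyring n). y \<oplus>\<^bsub>polyring n\<^esub> x = \<zero>\<^bsub>polyring n\<^esub>"
      by (metis polyring_simps(4,5))
  qed (auto simp: algebra_simps)
next
  show "comm_monoid (polyring n :: 'k mpoly ring)"
  proof (rule comm_monoidI)
    fix x y :: "'k mpoly"
    assume "x \<in> carrier (polyring n)" "y \<in> carrier (polyring n)"
    then have "{a + b |a b. a \<in> Poly_Mapping.keys x \<and> b \<in> Poly_Mapping.keys y} \<subseteq> monomials n"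
      by (auto simp: monomials_add)
    with keys_mult[of x y] have "Poly_Mapping.keys (x * y) \<subseteq> monomials n"
      by (rule subset_trans)
    then show "x \<otimes>\<^bsub>polyring n\<^esub> y \<in> carrier (polyring n)" by simp
  qed (auto simp: algebra_simps monomials_def)
qed (auto simp: algebra_simps)

lemma mpoly_expand:
  fixes p :: "'k::field mpoly"
  shows "p = (\<Sum>t\<in>Poly_Mapping.keys p. Poly_Mapping.single t (Poly_Mapping.lookup p t))"
  by (rule poly_mapping_eqI)
     (auto simp: lookup_sum lookup_single when_def in_keys_iff sum.delta)

lemma genideal_mon:
  fixes n :: nat
  assumes M: "M \<subseteq> monomials n"
  shows "genideal (polyring n) (monom_poly ` M) =
    {p :: 'k::field mpoly. Poly_Mapping.keys p \<subseteq> monomials n \<and> (\<forall>t\<in>Poly_Mapping.keys p. \<exists>s\<in>M. \<exists>c. t = s + c)}" (is "?L = ?R")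
proof
  interpret R: cring "polyring n :: 'k mpoly ring" by (rule polyring_cring)
  have neg: "\<ominus>\<^bsub>polyring n\<^esub> x = - x" if "x \<in> carrier (polyring n)" for x :: "'k mpoly"
  proof (rule R.minus_equality)
    show "- x \<in> carrier (polyring n)" using that by (auto simp: in_keys_iff)
  qed (use that in auto)
  have mR: "x * y \<in> ?R" if "x \<in> ?R" "Poly_Mapping.keys y \<subseteq> monomials n" for x y
  proof -
    have "\<exists>s\<in>M. \<exists>c. t = s + c" if t: "t \<in> Poly_Mapping.keys (x * y)" for t
    proof -
      from t obtain a b where ab: "a \<in> Poly_Mapping.keys x" "t = a + b"
        using keys_mult[of x y] by blast
      with \<open>x \<in> ?R\<close> obtain s c where "s \<in> M" "a = s + c" by blast
      then show ?thesis using ab by (auto intro!: bexI[of _ s] exI[of _ "c + b"] simp: add.assoc)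
    qed
    moreover have "Poly_Mapping.keys (x * y) \<subseteq> monomials n"
      using R.m_closed[of x y] that by auto
    ultimately show ?thesis by blast
  qed
  have idR: "ideal ?R (polyring n)"
  proof (rule idealI)
    show "ring (polyring n :: 'k mpoly ring)" by unfold_locales
    show "subgroup ?R (add_monoid (polyring n))"
    proof
      fix x y assume "x \<in> ?R" "y \<in> ?R"
      then show "x \<otimes>\<^bsub>add_monoid (polyring n)\<^esub> y \<in> ?R"
        using keys_add[of x y] by auto
    next
      fix x assume x: "x \<in> ?R"
      have "inv\<^bsub>add_monoid (polyring n)\<^esub> x = - x"
        using neg[of x] x by (simp add: a_inv_def)
      then show "inv\<^bsub>add_monoid (polyring n)\<^esub> x \<in> ?R"
        using x by (auto simp: in_keys_iff)
    qed auto
    fix a x :: "'k mpoly"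
    assume ax: "a \<in> ?R" "x \<in> carrier (polyring n)"
    then show "a \<otimes>\<^bsub>polyring n\<^esub> x \<in> ?R" using mR by auto
    then show "x \<otimes>\<^bsub>polyring n\<^esub> a \<in> ?R" by (simp add: mult.commute)
  qed
  have "monom_poly ` M \<subseteq> ?R"
    using M by (auto simp: monom_poly_def monomials_def intro!: exI[of _ 0])
  then show "?L \<subseteq> ?R"
    by (rule R.genideal_minimal[OF idR])
  have sub: "monom_poly ` M \<subseteq> carrier (polyring n :: 'k mpoly ring)"
    using M by (auto simp: monom_poly_def)
  have idL: "ideal ?L (polyring n)" using R.genideal_ideal[OF sub] .
  interpret L: ideal ?L "polyring n :: 'k mpoly ring" by (rule idL)
  show "?R \<subseteq> ?L"
  proof
    fix p assume p: "p \<in> ?R"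
    have one: "Poly_Mapping.single t (Poly_Mapping.lookup p t) \<in> ?L" if t: "t \<in> Poly_Mapping.keys p" for t
    proof -
      from p t obtain s c where s: "s \<in> M" "t = s + c" by blast
      from p t have "t \<in> monomials n" by blast
      with s have c: "c \<in> monomials n" by (simp add: monomials_add)
      have "monom_poly s \<in> ?L" using R.genideal_self[OF sub] s by blast
      moreover have "Poly_Mapping.single c (Poly_Mapping.lookup p t) \<in> carrier (polyring n)"
        using c by simp
      ultimately have "monom_poly s * Poly_Mapping.single c (Poly_Mapping.lookup p t) \<in> ?L"
        using L.I_r_closed by fastforce
      then show ?thesis by (simp add: monom_poly_def mult_single s)
    qed
    have zero: "(0 :: 'k mpoly) \<in> ?L" using L.zero_closed by simp
    have add: "x + y \<in> ?L" if "x \<in> ?L" "y \<in> ?L" for x y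
      using L.a_closed[OF that] by simp
    have "(\<Sum>t\<in>T. Poly_Mapping.single t (Poly_Mapping.lookup p t)) \<in> ?L"
      if "finite T" "T \<subseteq> Poly_Mapping.keys p" for T
      using that by (induction T rule: finite_induct) (auto intro!: zero add one)
    then show "p \<in> ?L" using mpoly_expand[of p] by (metis finite_keys subset_refl)
  qed
qed

lemma monomial_ideal_iff:
  "monomial_ideal n (I :: 'k::field mpoly set) \<longleftrightarrow>
     I = {p. Poly_Mapping.keys p \<subseteq> monomials n \<and> (\<forall>t\<in>Poly_Mapping.keys p. monom_poly t \<in> I)} \<and>
     (\<forall>s c. monom_poly s \<in> I \<longrightarrow> c \<in> monomials n \<longrightarrow> monom_poly (s + c) \<in> I)" (is "?A \<longleftrightarrow> ?B")
proof
  assume ?A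
  then obtain M where M: "M \<subseteq> monomials n" "I = genideal (polyring n) (monom_poly ` M)"
    by (auto simp: monomial_ideal_def)
  have I: "I = {p. Poly_Mapping.keys p \<subseteq> monomials n \<and> (\<forall>t\<in>Poly_Mapping.keys p. \<exists>s\<in>M. \<exists>c. t = s + c)}"
    using genideal_mon[OF M(1)] M(2) by simp
  have mI: "monom_poly t \<in> I \<longleftrightarrow> t \<in> monomials n \<and> (\<exists>s\<in>M. \<exists>c. t = s + c)" for t
    by (simp add: I monom_poly_def)
  have "monom_poly (s + c) \<in> I" if "monom_poly s \<in> I" "c \<in> monomials n" for s c
  proof -
    from that obtain r d where "r \<in> M" "s = r + d" "s \<in> monomials n" unfolding mI by blast
    moreover from this have "s + c = r + (d + c)" by (simp add: add.assoc)
    ultimately show ?thesis using that(2) unfolding mI monomials_add by blast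
  qed
  moreover have "p \<in> I \<longleftrightarrow> Poly_Mapping.keys p \<subseteq> monomials n \<and> (\<forall>t\<in>Poly_Mapping.keys p. monom_poly t \<in> I)" for p
    unfolding mI by (subst I) blast
  ultimately show ?B by blast
next
  assume B: ?B
  define M where "M = {t. monom_poly t \<in> I}"
  have mem: "p \<in> I \<longleftrightarrow> Poly_Mapping.keys p \<subseteq> monomials n \<and> (\<forall>t\<in>Poly_Mapping.keys p. monom_poly t \<in> I)" for p
    using B by blast
  have Mn: "M \<subseteq> monomials n"
  proof
    fix t assume "t \<in> M"
    then have "(monom_poly t :: 'k mpoly) \<in> I" by (simp add: M_def)
    with mem[of "monom_poly t"] show "t \<in> monomials n" by (simp add: monom_poly_def)
  qed
  have up: "(\<exists>s\<in>M. \<exists>c. t = s + c) \<longleftrightarrow> monom_poly t \<in> I" if "t \<in> monomials n" for t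
    using B that by (metis M_def mem_Collect_eq monomials_add add_0_right)
  have "I = genideal (polyring n) (monom_poly ` M)"
  proof (rule Set.set_eqI)
    fix p
    show "p \<in> I \<longleftrightarrow> p \<in> genideal (polyring n) (monom_poly ` M)"
      unfolding genideal_mon[OF Mn] mem_Collect_eq mem[of p] using up
      by (intro conj_cong ball_cong) auto
  qed
  then show ?A using Mn by (auto simp: monomial_ideal_def)
qed

lemma lookup_psi_exp: "Poly_Mapping.lookup (psi_exp w t) i = w i * Poly_Mapping.lookup t i"
  by (simp add: psi_exp_def lookup_mapp when_def in_keys_iff)

lemma psi_exp_add: "psi_exp w (s + t) = psi_exp w s + psi_exp w t"
  by (rule poly_mapping_eqI) (simp add: lookup_psi_exp lookup_add algebra_simps)

lemma mon_add: "monom_poly (s + t) = monom_poly s * monom_poly t"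
  by (simp add: monom_poly_def mult_single)

lemma mon_varm_power: "monom_poly (varm i) ^ k = monom_poly (Poly_Mapping.single i k)"
  by (induction k)
     (simp_all add: mon_add[symmetric] varm_def single_add[symmetric] monom_poly_def[of 0])

lemma mon_single_power:
  "monom_poly (Poly_Mapping.single i l) ^ k = monom_poly (Poly_Mapping.single i (l * k))"
  by (induction k)
     (simp_all add: mon_add[symmetric] single_add[symmetric] monom_poly_def[of 0])

lemma mon_sum: "(\<Prod>i\<in>A. monom_poly (f i)) = monom_poly (\<Sum>i\<in>A. f i)"
  by (induction A rule: infinite_finite_induct) (simp_all add: mon_add monom_poly_def[of 0])

lemma psi_alt:
  "psi w p = (\<Sum>t\<in>Poly_Mapping.keys p. Poly_Mapping.single (psi_exp w t) (Poly_Mapping.lookup p t))"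
proof -
  have "(\<Prod>i\<in>Poly_Mapping.keys t. (monom_poly (varm i) ^ w i) ^ Poly_Mapping.lookup t i) =
      (monom_poly (psi_exp w t) :: 'a mpoly)" for t
  proof -
    have "psi_exp w t = (\<Sum>i\<in>Poly_Mapping.keys t. Poly_Mapping.single i (w i * Poly_Mapping.lookup t i))"
      by (rule poly_mapping_eqI)
         (auto simp: lookup_sum lookup_single when_def in_keys_iff lookup_psi_exp)
    then show ?thesis
      by (simp add: mon_varm_power mon_single_power mon_sum)
  qed
  then show ?thesis
    by (simp add: psi_def const_def monom_poly_def mult_single)
qed

lemma psi_mon: "psi w (monom_poly t) = monom_poly (psi_exp w t)"
  by (simp add: psi_alt monom_poly_def)

lemma psi_single: "psi w (Poly_Mapping.single t c) = Poly_Mapping.single (psi_exp w t) c"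
  by (simp add: psi_alt)

lemma psi_const: "psi w (const c) = const c"
proof -
  have "psi_exp w 0 = 0" by (rule poly_mapping_eqI) (simp add: lookup_psi_exp)
  then show ?thesis by (simp add: const_def psi_single)
qed

lemma psi_var: "psi w (monom_poly (varm i)) = monom_poly (varm i) ^ w i"
proof -
  have "psi_exp w (varm i) = Poly_Mapping.single i (w i)"
    by (rule poly_mapping_eqI) (simp add: lookup_psi_exp varm_def lookup_single when_def)
  then show ?thesis by (simp add: psi_mon mon_varm_power)
qed

lemma psi_add: "psi w (p + q) = psi w p + psi w q"
proof -
  let ?f = "\<lambda>p t. Poly_Mapping.single (psi_exp w t) (Poly_Mapping.lookup p t)"
  let ?K = "Poly_Mapping.keys p \<union> Poly_Mapping.keys q"
  have ext: "psi w r = (\<Sum>t\<in>?K. ?f r t)" if "Poly_Mapping.keys r \<subseteq> ?K" for r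
    unfolding psi_alt using that
    by (intro sum.mono_neutral_left) (auto simp: in_keys_iff)
  have "psi w (p + q) = (\<Sum>t\<in>?K. ?f p t + ?f q t)"
    using ext[of "p + q"] keys_add[of p q] by (simp add: lookup_add single_add)
  also have "\<dots> = psi w p + psi w q"
    by (simp add: sum.distrib ext[of p] ext[of q])
  finally show ?thesis .
qed

lemma psi_sum: "psi w (\<Sum>x\<in>A. f x) = (\<Sum>x\<in>A. psi w (f x))"
  by (induction A rule: infinite_finite_induct) (simp_all add: psi_add, simp_all add: psi_def)

lemma psi_mult: "psi w (p * q) = psi w p * psi w q"
proof -
  let ?e = "\<lambda>p t. Poly_Mapping.single t (Poly_Mapping.lookup p t)"
  have "psi w (p * q) = psi w ((\<Sum>s\<in>Poly_Mapping.keys p. ?e p s) * (\<Sum>t\<in>Poly_Mapping.keys q. ?e q t))"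
    by (simp add: mpoly_expand[symmetric])
  also have "\<dots> = (\<Sum>s\<in>Poly_Mapping.keys p. psi w (?e p s)) * (\<Sum>t\<in>Poly_Mapping.keys q. psi w (?e q t))"
    by (simp add: sum_product psi_sum mult_single psi_single psi_exp_add)
  also have "\<dots> = psi w p * psi w q"
    by (simp only: psi_single) (simp only: psi_alt)
  finally show ?thesis .
qed

lemma psi_closed: "Poly_Mapping.keys p \<subseteq> monomials n \<Longrightarrow> Poly_Mapping.keys (psi w p) \<subseteq> monomials n"
proof -
  assume p: "Poly_Mapping.keys p \<subseteq> monomials n"
  have sub: "Poly_Mapping.keys (psi_exp w t) \<subseteq> Poly_Mapping.keys t" for t
    by (auto simp: in_keys_iff lookup_psi_exp)
  show ?thesis
  proof
    fix u assume "u \<in> Poly_Mapping.keys (psi w p)"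
    then have "u \<in> (\<Union>t\<in>Poly_Mapping.keys p.
        Poly_Mapping.keys (Poly_Mapping.single (psi_exp w t) (Poly_Mapping.lookup p t)))"
      unfolding psi_alt by (rule subsetD[OF keys_sum])
    then obtain t where "t \<in> Poly_Mapping.keys p" "u = psi_exp w t"
      by (auto split: if_splits)
    then show "u \<in> monomials n" using p sub[of t] by (auto simp: monomials_def)
  qed
qed

lemma psi_ring_hom: "psi w \<in> ring_hom (polyring n) (polyring n :: 'k::field mpoly ring)"
proof (rule ring_hom_memI)
  show "psi w \<one>\<^bsub>polyring n\<^esub> = \<one>\<^bsub>polyring n :: 'k mpoly ring\<^esub>"
    using psi_const[of w 1] by (simp add: const_def)
qed (simp_all add: psi_closed psi_add psi_mult)

lemma monomials_wf:
  assumes "t \<in> A"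
  shows "\<exists>s\<in>A. (\<exists>c. t = s + c) \<and> (\<forall>u\<in>A. (\<exists>c. s = u + c) \<longrightarrow> u = (s :: monomial))"
  using assms
proof (induction "wdeg (\<lambda>_. 1) t" arbitrary: t rule: less_induct)
  case less
  show ?case
  proof (cases "\<forall>u\<in>A. (\<exists>c. t = u + c) \<longrightarrow> u = t")
    case True
    then show ?thesis using less.prems by (metis add_0_right)
  next
    case False
    then obtain u c where u: "u \<in> A" "t = u + c" "u \<noteq> t" by blast
    then have c: "c \<noteq> 0" by auto
    have ext: "wdeg (\<lambda>_. 1) v = (\<Sum>i\<in>Poly_Mapping.keys u \<union> Poly_Mapping.keys c. Poly_Mapping.lookup v i)"
      if "Poly_Mapping.keys v \<subseteq> Poly_Mapping.keys u \<union> Poly_Mapping.keys c" for v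
      unfolding wdeg_def using that
      by (simp, intro sum.mono_neutral_left) (auto simp: in_keys_iff)
    from c have "Poly_Mapping.keys c \<noteq> {}" by (metis keys_eq_empty)
    then obtain i where i: "i \<in> Poly_Mapping.keys c" by blast
    have "wdeg (\<lambda>_. 1) c > 0"
      unfolding wdeg_def using i by (auto simp: sum_pos2 in_keys_iff)
    moreover have "wdeg (\<lambda>_. 1) t = wdeg (\<lambda>_. 1) u + wdeg (\<lambda>_. 1) c"
      using ext[of t] ext[of u] ext[of c] keys_add[of u c] u(2)
      by (simp add: lookup_add sum.distrib)
    ultimately have "wdeg (\<lambda>_. 1) u < wdeg (\<lambda>_. 1) t" by simp
    from less.hyps[OF this u(1)] u(2) show ?thesis by (metis add.assoc)
  qed
qed

lemma minimal_generators_eq: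
  fixes I :: "'k::field mpoly set"
  assumes "monomial_ideal n I"
  defines "G \<equiv> {t. monom_poly t \<in> I \<and> (\<forall>s. monom_poly s \<in> I \<longrightarrow> (\<exists>c. t = s + c) \<longrightarrow> s = t)}"
  shows "generates n G I"
    and "generates n M I \<Longrightarrow> G \<subseteq> M"
    and "min_gens n I = G"
proof -
  have I: "I = {p. Poly_Mapping.keys p \<subseteq> monomials n \<and> (\<forall>t\<in>Poly_Mapping.keys p. monom_poly t \<in> I)}"
    and up: "\<And>s c. monom_poly s \<in> I \<Longrightarrow> c \<in> monomials n \<Longrightarrow> monom_poly (s + c) \<in> I"
    using assms(1) unfolding monomial_ideal_iff by blast+
  have mn: "t \<in> monomials n" if "monom_poly t \<in> I" for t
  proof -
    have "Poly_Mapping.keys (monom_poly t :: 'k mpoly) \<subseteq> monomials n" using that I by blast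
    then show ?thesis by (simp add: monom_poly_def)
  qed
  have Gn: "G \<subseteq> monomials n" using mn by (auto simp: G_def)
  have cov: "monom_poly t \<in> I \<longleftrightarrow> (\<exists>s\<in>G. \<exists>c. t = s + c)" if "t \<in> monomials n" for t
  proof
    assume "monom_poly t \<in> I"
    then show "\<exists>s\<in>G. \<exists>c. t = s + c"
      using monomials_wf[of t "{t. monom_poly t \<in> I}"] by (auto simp: G_def)
  next
    assume "\<exists>s\<in>G. \<exists>c. t = s + c"
    then show "monom_poly t \<in> I" using that up by (auto simp: G_def monomials_add)
  qed
  show gen: "generates n G I"
  proof -
    have "p \<in> I \<longleftrightarrow> Poly_Mapping.keys p \<subseteq> monomials n \<and>
        (\<forall>t\<in>Poly_Mapping.keys p. \<exists>s\<in>G. \<exists>c. t = s + c)" for p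
      by (subst I) (use cov in blast)
    then show ?thesis unfolding generates_def genideal_mon[OF Gn] using Gn by blast
  qed
  show least: "G \<subseteq> M" if "generates n M I" for M
  proof
    fix t assume t: "t \<in> G"
    from that have M: "M \<subseteq> monomials n"
      and IM: "I = {p. Poly_Mapping.keys p \<subseteq> monomials n \<and> (\<forall>t\<in>Poly_Mapping.keys p. \<exists>s\<in>M. \<exists>c. t = s + c)}"
      using genideal_mon[of M n] by (auto simp: generates_def)
    have "monom_poly t \<in> I" using t by (simp add: G_def)
    then obtain s c where s: "s \<in> M" "t = s + c" using IM by (auto simp: monom_poly_def)
    have "monom_poly s \<in> I" using s(1) M by (subst IM) (auto simp: monom_poly_def intro!: bexI[of _ s] exI[of _ 0])
    then have "s = t" using t s(2) by (auto simp: G_def)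
    then show "t \<in> M" using s by simp
  qed
  show "min_gens n I = G"
    unfolding min_gens_def
  proof (rule the_equality)
    show "generates n G I \<and> (\<forall>M'. M' \<subset> G \<longrightarrow> \<not> generates n M' I)"
      using gen least by blast
  next
    fix M assume "generates n M I \<and> (\<forall>M'. M' \<subset> M \<longrightarrow> \<not> generates n M' I)"
    then show "M = G" using gen least by blast
  qed
qed

lemma Borel_least:
  fixes \<mu> :: monomial
  assumes \<mu>: "\<mu> \<in> monomials n"
  shows "strongly_stable n (Borel n (monom_poly \<mu>) :: 'k::field mpoly set)"
    and "monom_poly \<mu> \<in> (Borel n (monom_poly \<mu>) :: 'k mpoly set)"
    and "strongly_stable n I \<Longrightarrow> monom_poly \<mu> \<in> I \<Longrightarrow> Borel n (monom_poly \<mu>) \<subseteq> (I :: 'k mpoly set)"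
proof -
  let ?F = "{I :: 'k mpoly set. strongly_stable n I \<and> monom_poly \<mu> \<in> I}"
  let ?B = "Borel n (monom_poly \<mu>) :: 'k mpoly set"
  let ?C = "{p :: 'k mpoly. Poly_Mapping.keys p \<subseteq> monomials n}"
  have keysm: "Poly_Mapping.keys (monom_poly t :: 'k mpoly) = {t}" for t by (simp add: monom_poly_def)
  have sum_monos: "(\<Sum>(i, j)\<leftarrow>ps. varm i) \<in> monomials n"
    if "\<forall>(i, j)\<in>set ps. 1 \<le> i \<and> i < j \<and> j \<le> n" for ps
    using that
    by (induction ps) (auto simp: monomials_add, auto simp: monomials_def varm_def)
  have "borel_move n t u \<Longrightarrow> t \<in> monomials n \<Longrightarrow> u \<in> monomials n" for t u
    unfolding borel_move_def using sum_monos by (auto simp: monomials_add)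
  then have C: "?C \<in> ?F"
    unfolding strongly_stable_def monomial_ideal_iff using \<mu> by (auto simp: keysm monomials_add)
  define F where "F = ?F"
  have mem: "p \<in> ?B \<longleftrightarrow> (\<forall>I\<in>F. p \<in> I)" for p
    unfolding Borel_def F_def by blast
  have CF: "?C \<in> F" using C unfolding F_def .
  have Fmem: "p \<in> I \<longleftrightarrow> Poly_Mapping.keys p \<subseteq> monomials n \<and> (\<forall>t\<in>Poly_Mapping.keys p. monom_poly t \<in> I)"
    and Fup: "\<And>s c. monom_poly s \<in> I \<Longrightarrow> c \<in> monomials n \<Longrightarrow> monom_poly (s + c) \<in> I"
    and Fmove: "\<And>t u. t \<in> monomials n \<Longrightarrow> monom_poly t \<in> I \<Longrightarrow> borel_move n t u \<Longrightarrow>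
      monom_poly u \<in> I"
    if "I \<in> F" for I p
    using that unfolding F_def strongly_stable_def monomial_ideal_iff by blast+
  have eq: "p \<in> ?B \<longleftrightarrow> Poly_Mapping.keys p \<subseteq> monomials n \<and> (\<forall>t\<in>Poly_Mapping.keys p. monom_poly t \<in> ?B)" for p
  proof -
    have "(\<forall>I\<in>F. p \<in> I) \<longleftrightarrow>
        (\<forall>I\<in>F. Poly_Mapping.keys p \<subseteq> monomials n \<and> (\<forall>t\<in>Poly_Mapping.keys p. monom_poly t \<in> I))"
      using Fmem by (intro ball_cong) simp_all
    also have "\<dots> \<longleftrightarrow> Poly_Mapping.keys p \<subseteq> monomials n \<and> (\<forall>t\<in>Poly_Mapping.keys p. \<forall>I\<in>F. monom_poly t \<in> I)"
      using CF by auto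
    finally show ?thesis by (simp only: mem)
  qed
  have "?B = {p. Poly_Mapping.keys p \<subseteq> monomials n \<and> (\<forall>t\<in>Poly_Mapping.keys p. monom_poly t \<in> ?B)}"
    by (rule Set.set_eqI) (simp only: mem_Collect_eq, rule eq)
  moreover have "\<forall>s c. monom_poly s \<in> ?B \<longrightarrow> c \<in> monomials n \<longrightarrow> monom_poly (s + c) \<in> ?B"
    by (simp add: mem Fup)
  ultimately have "monomial_ideal n ?B" unfolding monomial_ideal_iff by (rule conjI)
  then show "strongly_stable n ?B"
    unfolding strongly_stable_def by (auto simp: mem intro: Fmove)
  show "monom_poly \<mu> \<in> ?B" unfolding Borel_def by blast
  show "strongly_stable n I \<Longrightarrow> monom_poly \<mu> \<in> I \<Longrightarrow> ?B \<subseteq> I" unfolding Borel_def by blast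
qed

lemma sorted_mono_word: "sorted (mono_word t)"
proof -
  have "sorted (concat (map (\<lambda>i. replicate (f i) i) xs))" if "sorted xs"
    for xs and f :: "nat \<Rightarrow> nat"
    using that by (induction xs) (auto simp: sorted_append)
  then show ?thesis by (simp add: mono_word_def)
qed

lemma sum_mono_word: "(\<Sum>i\<leftarrow>mono_word t. varm i) = t"
proof -
  have rep: "(\<Sum>j\<leftarrow>replicate k i. varm j) = Poly_Mapping.single i k" for k i
    by (induction k) (simp_all add: varm_def single_add[symmetric])
  have rep: "sum_list (replicate k (varm i)) = Poly_Mapping.single i k" for k i
    using rep[of k i] by simp
  have "(\<Sum>i\<leftarrow>concat (map (\<lambda>i. replicate (f i) i) xs). varm i) =
      (\<Sum>i\<leftarrow>xs. Poly_Mapping.single i (f i))" for xs and f :: "nat \<Rightarrow> nat"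
    by (induction xs) (simp_all add: rep)
  then have "(\<Sum>i\<leftarrow>mono_word t. varm i) =
      (\<Sum>i\<in>Poly_Mapping.keys t. Poly_Mapping.single i (Poly_Mapping.lookup t i))"
    by (simp add: mono_word_def sum_list_distinct_conv_sum_set)
  also have "\<dots> = t"
    by (rule poly_mapping_eqI) (auto simp: lookup_sum lookup_single when_def in_keys_iff)
  finally show ?thesis .
qed

end

theory Submission
  imports Defs
begin

text \<open>
  Borel(\<mu>) contains exactly the monomials all of whose partial exponent sums dominate those of \<mu>.
  Hence \<open>x\<^sup>u\<close> lies in the weighted closure of m iff every partial weighted degree of u dominates
  that of m, and since the weights decrease it is a minimal generator iff moreover removing its last
  variable drops the degree below d. Stripping the last variable of such monomials, with the
  domination required only below the last index, yields the recursion of the diagram.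
\<close>

section \<open>Partial sums of exponents\<close>

text \<open>Index 0 carries no variable; including it keeps \<open>psum_Suc\<close> and
  \<open>psum_inject\<close> free of side conditions.\<close>

definition psum :: "nat \<Rightarrow> monomial \<Rightarrow> nat" where
  "psum k t = (\<Sum>i\<le>k. Poly_Mapping.lookup t i)"

lemma psum_add: "psum k (s + t) = psum k s + psum k t"
  by (simp add: psum_def lookup_add sum.distrib)

lemma psum_zero [simp]: "psum k 0 = 0"
  by (simp add: psum_def)

lemma psum_single: "psum k (Poly_Mapping.single i c) = (if i \<le> k then c else 0)"
  by (simp add: psum_def lookup_single when_def)

lemma psum_varm: "psum k (varm i) = (if i \<le> k then 1 else 0)"
  by (simp add: varm_def psum_single)

lemma psum_mono: "k \<le> l \<Longrightarrow> psum k t \<le> psum l t"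
  unfolding psum_def by (rule sum_mono2) auto

lemma psum_stable:
  assumes "Poly_Mapping.keys t \<subseteq> {..k}" "k \<le> l"
  shows "psum l t = psum k t"
  unfolding psum_def
proof (rule sum.mono_neutral_right)
  show "\<forall>i\<in>{..l} - {..k}. Poly_Mapping.lookup t i = 0"
    using assms(1) in_keys_iff[of _ t] by fastforce
qed (use assms(2) in auto)

lemma psum_Suc: "psum (Suc k) t = psum k t + Poly_Mapping.lookup t (Suc k)"
  by (simp add: psum_def)

lemma psum_0_monomials: "t \<in> monomials n \<Longrightarrow> psum 0 t = 0"
  by (auto simp: psum_def monomials_def in_keys_iff)

lemma psum_monomials:
  assumes "t \<in> monomials n" "n \<le> k"
  shows "psum k t = psum n t"
  using assms by (intro psum_stable) (auto simp: monomials_def)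

lemma psum_inject:
  assumes "\<And>k. psum k s = psum k t"
  shows "s = t"
proof (rule poly_mapping_eqI)
  fix i
  show "Poly_Mapping.lookup s i = Poly_Mapping.lookup t i"
  proof (cases i)
    case 0
    then show ?thesis using assms[of 0] by (simp add: psum_def)
  next
    case (Suc j)
    then show ?thesis using assms[of j] assms[of i] by (simp add: psum_Suc)
  qed
qed

lemma monomials_zero [simp]: "0 \<in> monomials n"
  by (simp add: monomials_def)

lemma varm_monomials: "varm i \<in> monomials n \<longleftrightarrow> 1 \<le> i \<and> i \<le> n"
  by (simp add: monomials_def varm_def)

text \<open>Subtraction of exponents is truncated at 0, so cancelling and restoring a variable
  requires that it occur.\<close>

lemma varm_divides:
  assumes "i \<in> Poly_Mapping.keys t"
  shows "t = (t - varm i) + varm i"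
  using assms
  by (intro poly_mapping_eqI)
     (auto simp: lookup_add lookup_minus varm_def lookup_single when_def in_keys_iff)


section \<open>Principal strongly stable ideals\<close>

lemma borel_move_monomials:
  assumes "borel_move n t u" "t \<in> monomials n"
  shows "u \<in> monomials n"
proof -
  have "(\<Sum>(i, j)\<leftarrow>ps. varm i) \<in> monomials n"
    if "\<forall>(i, j)\<in>set ps. 1 \<le> i \<and> i < j \<and> j \<le> n" for ps
    using that by (induction ps) (auto simp: monomials_add varm_monomials)
  then show ?thesis using assms unfolding borel_move_def by (auto simp: monomials_add)
qed

text \<open>Each exchange replaces a variable by one of smaller index, which enters the partial sums
  no later.\<close>

lemma borel_move_psum:
  assumes "borel_move n t u"
  shows "psum k t \<le> psum k u"
proof -
  have "psum k (\<Sum>(i, j)\<leftarrow>ps. varm j) \<le> psum k (\<Sum>(i, j)\<leftarrow>ps. varm i)"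
    if "\<forall>(i, j)\<in>set ps. 1 \<le> i \<and> i < j \<and> j \<le> n" for ps
    using that by (induction ps) (auto simp: psum_add psum_varm)
  then show ?thesis using assms unfolding borel_move_def by (auto simp: psum_add)
qed

lemma borel_move_exchange:
  assumes "1 \<le> i" "i < j" "j \<le> n"
  shows "borel_move n (c + varm j) (c + varm i)"
  unfolding borel_move_def using assms by (intro exI[of _ "[(i, j)]"] exI[of _ c]) simp

text \<open>
  At the last index k where the partial sums of u and t differ, raising the k-th partial sum of t
  by one is a single exchange of \<open>k + 1\<close> for k, or a multiplication by the last variable.
\<close>

lemma strongly_stable_dominating:
  fixes I :: "'k::field mpoly set"
  assumes I: "strongly_stable n I"
    and "t \<in> monomials n" "u \<in> monomials n" "monom_poly t \<in> I"
    and "\<And>k. psum k t \<le> psum k u"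
  shows "monom_poly u \<in> I"
  using assms(2-)
\<comment> \<open>The measure is the total defect of the partial sums; each step lowers it by one,
  at the index k only.\<close>
proof (induction "\<Sum>k\<le>n. psum k u - psum k t" arbitrary: t rule: less_induct)
  case less
  note tn = less.prems(1) and un = less.prems(2) and tI = less.prems(3) and le = less.prems(4)
  have up: "\<And>s c. monom_poly s \<in> I \<Longrightarrow> c \<in> monomials n \<Longrightarrow> monom_poly (s + c) \<in> I"
    using I unfolding strongly_stable_def monomial_ideal_iff by blast
  have mv: "\<And>s v. s \<in> monomials n \<Longrightarrow> monom_poly s \<in> I \<Longrightarrow> borel_move n s v \<Longrightarrow> monom_poly v \<in> I"
    using I unfolding strongly_stable_def by blast
  define K where "K = {k. k \<le> n \<and> psum k t < psum k u}"
  show ?case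
  proof (cases "K = {}")
    case True
    have "psum k t = psum k u" for k
    proof (cases "k \<le> n")
      case True
      then show ?thesis using \<open>K = {}\<close> le[of k] by (auto simp: K_def)
    next
      case False
      then show ?thesis
        using \<open>K = {}\<close> le[of n] psum_monomials[OF tn, of k] psum_monomials[OF un, of k]
        by (auto simp: K_def)
    qed
    then show ?thesis using psum_inject[of t u] tI by simp
  next
    case False
    define k where "k = Max K"
    have fin: "finite K" by (simp add: K_def)
    then have kK: "k \<in> K" using False unfolding k_def by (rule Max_in)
    have kmax: "l \<le> k" if "l \<in> K" for l using fin that by (simp add: k_def)
    have kn: "k \<le> n" and klt: "psum k t < psum k u" using kK by (auto simp: K_def)
    have k1: "1 \<le> k"
      using klt psum_0_monomials[OF un] by (cases k) auto
    obtain t' where t': "t' \<in> monomials n" "monom_poly t' \<in> I"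
      and incr: "\<And>l. l \<le> n \<Longrightarrow> psum l t' = (if l = k then psum l t + 1 else psum l t)"
    proof (cases "k = n")
      case True
      show ?thesis
      proof (rule that[of "t + varm n"])
        show "monom_poly (t + varm n) \<in> I" using k1 True by (intro up tI) (simp add: varm_monomials)
      qed (use tn k1 True in \<open>auto simp: monomials_add varm_monomials psum_add psum_varm\<close>)
    next
      case False
      then have Sn: "Suc k \<le> n" using kn by simp
      have "\<not> psum (Suc k) t < psum (Suc k) u" using kmax[of "Suc k"] Sn by (auto simp: K_def)
      \<comment> \<open>The sums agree at \<open>Suc k\<close> but t is behind at k, so t must catch
        up there by a positive exponent.\<close>
      then have "Suc k \<in> Poly_Mapping.keys t"
        using klt le[of "Suc k"] by (simp add: in_keys_iff psum_Suc)
      then have dec: "t = (t - varm (Suc k)) + varm (Suc k)" by (rule varm_divides)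
      define c where "c = t - varm (Suc k)"
      have t: "t = c + varm (Suc k)" using dec by (simp add: c_def)
      have bm: "borel_move n t (c + varm k)"
        unfolding t using k1 Sn by (intro borel_move_exchange) auto
      show ?thesis
      proof (rule that[of "c + varm k"])
        show "c + varm k \<in> monomials n" using bm tn by (rule borel_move_monomials)
        show "monom_poly (c + varm k) \<in> I" using tn tI bm by (rule mv)
      qed (auto simp: t psum_add psum_varm)
    qed
    have dom: "psum l t' \<le> psum l u" for l
    proof (cases "l \<le> n")
      case True
      then show ?thesis using incr[of l] klt le[of l] by auto
    next
      case False
      then show ?thesis
        using incr[of n] klt le[of n] psum_monomials[OF t'(1), of l] psum_monomials[OF un, of l]
        by (auto split: if_splits)
    qed
    have "(\<Sum>l\<le>n. psum l u - psum l t') < (\<Sum>l\<le>n. psum l u - psum l t)"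
    proof (rule sum_strict_mono_ex1)
      show "\<exists>l\<in>{..n}. psum l u - psum l t' < psum l u - psum l t"
        using incr[OF kn] klt kn by (intro bexI[of _ k]) auto
    qed (auto simp: incr)
    then show ?thesis using less.hyps t' un dom by blast
  qed
qed

text \<open>The dominating monomials span a strongly stable ideal containing t, which gives one
  inclusion by leastness. The other is \<open>strongly_stable_dominating\<close> applied to the
  Borel ideal itself.\<close>

lemma Borel_iff:
  assumes t: "t \<in> monomials n"
  shows "p \<in> (Borel n (monom_poly t) :: 'k::field mpoly set) \<longleftrightarrow>
    Poly_Mapping.keys p \<subseteq> monomials n \<and> (\<forall>u\<in>Poly_Mapping.keys p. \<forall>k. psum k t \<le> psum k u)"
proof -
  let ?D = "{p :: 'k mpoly. Poly_Mapping.keys p \<subseteq> monomials n \<and>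
    (\<forall>u\<in>Poly_Mapping.keys p. \<forall>k. psum k t \<le> psum k u)}"
  let ?B = "Borel n (monom_poly t) :: 'k mpoly set"
  have D_mon: "monom_poly u \<in> ?D \<longleftrightarrow> u \<in> monomials n \<and> (\<forall>k. psum k t \<le> psum k u)" for u
    by (simp add: monom_poly_def)
  have "strongly_stable n ?D"
    unfolding strongly_stable_def monomial_ideal_iff D_mon
    by (auto simp: monomials_add psum_add intro: trans_le_add1 borel_move_monomials
        order_trans[OF _ borel_move_psum])
  then have sub: "?B \<subseteq> ?D"
    using Borel_least(3)[OF t] D_mon t by blast
  have ss: "strongly_stable n ?B" and tB: "monom_poly t \<in> ?B" using Borel_least[OF t] by blast+
  have "?B = {p. Poly_Mapping.keys p \<subseteq> monomials n \<and> (\<forall>u\<in>Poly_Mapping.keys p. monom_poly u \<in> ?B)}"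
    using ss unfolding strongly_stable_def monomial_ideal_iff by blast
  moreover have "monom_poly u \<in> ?B" if "u \<in> monomials n" "\<forall>k. psum k t \<le> psum k u" for u
    using strongly_stable_dominating[OF ss t that(1) tB] that(2) by blast
  ultimately have "?D \<subseteq> ?B" by blast
  with sub show ?thesis by blast
qed


section \<open>The weighted closure and its minimal generators\<close>

lemma psi_exp_monomials: "t \<in> monomials n \<Longrightarrow> psi_exp w t \<in> monomials n"
  by (auto simp: monomials_def in_keys_iff lookup_psi_exp)

lemma psi_exp_varm: "psi_exp w (varm i) = Poly_Mapping.single i (w i)"
  by (rule poly_mapping_eqI) (simp add: lookup_psi_exp varm_def lookup_single when_def)

lemma wdeg_psum:
  assumes "Poly_Mapping.keys t \<subseteq> {..k}"
  shows "wdeg w t = psum k (psi_exp w t)"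
  unfolding wdeg_def psum_def lookup_psi_exp using assms
  by (intro sum.mono_neutral_left) (auto simp: in_keys_iff)

lemma psum_le_wdeg: "psum k (psi_exp w t) \<le> wdeg w t"
proof -
  obtain l where "Poly_Mapping.keys t \<subseteq> {..l}"
    using finite_nat_set_iff_bounded_le[of "Poly_Mapping.keys t"] by auto
  then have "Poly_Mapping.keys t \<subseteq> {..max k l}" by auto
  then have "wdeg w t = psum (max k l) (psi_exp w t)" by (rule wdeg_psum)
  then show ?thesis using psum_mono[of k "max k l"] by simp
qed

lemma wdeg_add: "wdeg w (s + t) = wdeg w s + wdeg w t"
proof -
  obtain l where "Poly_Mapping.keys s \<union> Poly_Mapping.keys t \<subseteq> {..l}"
    using finite_nat_set_iff_bounded_le[of "Poly_Mapping.keys s \<union> Poly_Mapping.keys t"] by auto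
  moreover from this have "Poly_Mapping.keys (s + t) \<subseteq> {..l}" using keys_add[of s t] by blast
  ultimately show ?thesis by (simp add: wdeg_psum[of _ l] psi_exp_add psum_add)
qed

lemma wdeg_varm: "wdeg w (varm i) = w i"
  by (simp add: wdeg_def varm_def)

lemma psi_exp_inject:
  assumes w: "weight_vector n w" and st: "s \<in> monomials n" "t \<in> monomials n"
    and eq: "psi_exp w s = psi_exp w t"
  shows "s = t"
proof (rule poly_mapping_eqI)
  fix i
  have i: "w i * Poly_Mapping.lookup s i = w i * Poly_Mapping.lookup t i"
    using arg_cong[OF eq, of "\<lambda>v. Poly_Mapping.lookup v i"] by (simp add: lookup_psi_exp)
  show "Poly_Mapping.lookup s i = Poly_Mapping.lookup t i"
  proof (cases "i \<in> {1..n}")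
    case True
    then have "0 < w i" using w by (simp add: weight_vector_def)
    then show ?thesis using i by simp
  next
    case False
    then have "i \<notin> Poly_Mapping.keys s" "i \<notin> Poly_Mapping.keys t"
      using st by (auto simp: monomials_def)
    then show ?thesis by (simp add: in_keys_iff)
  qed
qed

text \<open>By \<open>psi_exp_inject\<close> distinct monomials have distinct images, so no terms
  merge or cancel, and membership in the closure can be tested monomial by monomial.\<close>

lemma keys_psi:
  fixes p :: "'k::field mpoly"
  assumes w: "weight_vector n w" and p: "Poly_Mapping.keys p \<subseteq> monomials n"
  shows "Poly_Mapping.keys (psi w p) = psi_exp w ` Poly_Mapping.keys p"
proof
  show "Poly_Mapping.keys (psi w p) \<subseteq> psi_exp w ` Poly_Mapping.keys p"
  proof
    fix u assume "u \<in> Poly_Mapping.keys (psi w p)"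
    then have "u \<in> (\<Union>t\<in>Poly_Mapping.keys p.
        Poly_Mapping.keys (Poly_Mapping.single (psi_exp w t) (Poly_Mapping.lookup p t)))"
      unfolding psi_alt by (rule subsetD[OF keys_sum])
    then show "u \<in> psi_exp w ` Poly_Mapping.keys p" by (auto split: if_splits)
  qed
  show "psi_exp w ` Poly_Mapping.keys p \<subseteq> Poly_Mapping.keys (psi w p)"
  proof
    fix u assume "u \<in> psi_exp w ` Poly_Mapping.keys p"
    then obtain t where t: "t \<in> Poly_Mapping.keys p" "u = psi_exp w t" by blast
    have "Poly_Mapping.lookup (psi w p) u =
        (\<Sum>s\<in>Poly_Mapping.keys p. if s = t then Poly_Mapping.lookup p s else 0)"
      unfolding psi_alt lookup_sum
      using psi_exp_inject[OF w] p t
      by (intro sum.cong) (auto simp: lookup_single when_def)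
    also have "\<dots> = Poly_Mapping.lookup p t" using t(1) by simp
    finally show "u \<in> Poly_Mapping.keys (psi w p)" using t(1) by (simp add: in_keys_iff)
  qed
qed

lemma weighted_closure_iff:
  assumes w: "weight_vector n w" and m: "m \<in> monomials n"
  shows "p \<in> (weighted_closure n w m :: 'k::field mpoly set) \<longleftrightarrow>
    Poly_Mapping.keys p \<subseteq> monomials n \<and>
    (\<forall>u\<in>Poly_Mapping.keys p. \<forall>k. psum k (psi_exp w m) \<le> psum k (psi_exp w u))"
proof (cases "Poly_Mapping.keys p \<subseteq> monomials n")
  case True
  then have "psi_exp w ` Poly_Mapping.keys p \<subseteq> monomials n"
    using psi_exp_monomials by blast
  then show ?thesis
    using True
    by (simp add: weighted_closure_def psi_mon Borel_iff[OF psi_exp_monomials[OF m]] keys_psi[OF w])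
qed (simp add: weighted_closure_def)

lemma monom_weighted_closure_iff:
  assumes w: "weight_vector n w" and m: "m \<in> monomials n"
  shows "monom_poly u \<in> (weighted_closure n w m :: 'k::field mpoly set) \<longleftrightarrow>
    u \<in> monomials n \<and> (\<forall>k. psum k (psi_exp w m) \<le> psum k (psi_exp w u))"
  by (simp add: weighted_closure_iff[OF w m] monom_poly_def)

lemma monomial_ideal_weighted_closure:
  assumes w: "weight_vector n w" and m: "m \<in> monomials n"
  shows "monomial_ideal n (weighted_closure n w m :: 'k::field mpoly set)"
  unfolding monomial_ideal_iff monom_weighted_closure_iff[OF w m]
  by (auto simp: weighted_closure_iff[OF w m] monomials_add psi_exp_add psum_add
      intro: trans_le_add1)

section \<open>The last index of a monomial\<close>

lemma max_index_in_keys: "t \<noteq> 0 \<Longrightarrow> max_index t \<in> Poly_Mapping.keys t"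
  by (simp add: max_index_def)

lemma keys_le_max_index: "i \<in> Poly_Mapping.keys t \<Longrightarrow> i \<le> max_index t"
  by (auto simp: max_index_def)

lemma max_index_ge_1: "t \<in> monomials n \<Longrightarrow> 1 \<le> max_index t"
  using max_index_in_keys[of t]
  by (cases "t = 0") (auto simp: monomials_def max_index_def[of 0])

lemma keys_add_varm: "Poly_Mapping.keys (t + varm i :: monomial) = insert i (Poly_Mapping.keys t)"
  by (auto simp: in_keys_iff lookup_add varm_def lookup_single when_def split: if_splits)

lemma max_index_add_varm:
  assumes "max_index t \<le> i"
  shows "max_index (t + varm i) = i"
proof -
  have "t + varm i \<noteq> 0" using keys_add_varm[of t i] by (metis insert_not_empty keys_zero)
  moreover have "Max (Poly_Mapping.keys (t + varm i)) = i"
    using assms keys_le_max_index[of _ t]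
    by (intro Max_eqI) (auto simp: keys_add_varm intro: order_trans)
  ultimately show ?thesis by (simp add: max_index_def)
qed

text \<open>
  The monomials counted by the diagram; for degrees below that of m they need not belong to the
  weighted closure.
\<close>

definition diagram_monomials :: "nat \<Rightarrow> (nat \<Rightarrow> nat) \<Rightarrow> monomial \<Rightarrow> nat \<Rightarrow> nat \<Rightarrow> monomial set" where
  "diagram_monomials n w m a b = {u \<in> monomials n. max_index u = b \<and> wdeg w u = a \<and>
     a < wdeg w m + w b \<and> (\<forall>k<b. psum k (psi_exp w m) \<le> psum k (psi_exp w u))}"

text \<open>No exponents remain beyond the last index. From there on, domination becomes a
  comparison with the total degree.\<close>

lemma psum_psi_exp_ge:
  assumes "max_index t \<le> k"
  shows "psum k (psi_exp w t) = wdeg w t"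
  using wdeg_psum[of t k w] keys_le_max_index[of _ t] assms by fastforce

lemma min_gens_weighted_closure:
  assumes w: "weight_vector n w" and m: "m \<in> monomials n" and d: "wdeg w m \<le> a"
    and b: "1 \<le> b" "b \<le> n"
  shows "{g \<in> min_gens n (weighted_closure n w m :: 'k::field mpoly set).
    max_index g = b \<and> wdeg w g = a} = diagram_monomials n w m a b" (is "?G = ?D")
proof -
  let ?I = "weighted_closure n w m :: 'k mpoly set"
  note I = monom_weighted_closure_iff[OF w m, where ?'k = 'k]
  have gens: "g \<in> min_gens n ?I \<longleftrightarrow>
      monom_poly g \<in> ?I \<and> (\<forall>s. monom_poly s \<in> ?I \<longrightarrow> (\<exists>c. g = s + c) \<longrightarrow> s = g)" for g
    using minimal_generators_eq(3)[OF monomial_ideal_weighted_closure[OF w m], where ?'k = 'k]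
    by simp
  show ?thesis
  proof
    show "?G \<subseteq> ?D"
    proof
      fix g assume "g \<in> ?G"
      then have g: "g \<in> min_gens n ?I" "max_index g = b" "wdeg w g = a" by auto
      have gI: "g \<in> monomials n" "\<And>k. psum k (psi_exp w m) \<le> psum k (psi_exp w g)"
        using g(1) unfolding gens I by blast+
      have "a < wdeg w m + w b"
      proof (cases "g = 0")
        case True
        then have "a = 0" using g(3) by (simp add: wdeg_def)
        then show ?thesis using w b by (simp add: weight_vector_def)
      next
        case False
        define s where "s = g - varm b"
        have gs: "g = s + varm b"
          using varm_divides[of b g] max_index_in_keys[OF False] g(2) by (simp add: s_def)
        have sn: "s \<in> monomials n" using gI(1) gs by (simp add: monomials_add)
        have "Poly_Mapping.lookup g b = Suc (Poly_Mapping.lookup s b)"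
          by (simp add: gs lookup_add varm_def)
        then have "s \<noteq> g" by auto
        \<comment> \<open>Minimality puts the quotient of g by its last variable outside the ideal,
          so domination fails for it at some k.\<close>
        then have "monom_poly s \<notin> ?I" using g(1) gs unfolding gens by blast
        then obtain k where k: "psum k (psi_exp w s) < psum k (psi_exp w m)"
          using sn unfolding I by (auto simp: not_le)
        have split: "psum l (psi_exp w g) = psum l (psi_exp w s) + (if b \<le> l then w b else 0)" for l
          by (simp add: gs psi_exp_add psum_add psi_exp_varm psum_single)
        \<comment> \<open>Below b the sums of s and g agree, so the failure occurs at or after b.
          There the sum of s is \<open>a - w b\<close>, which is thus less than the degree of
          m.\<close>
        have bk: "b \<le> k" using gI(2)[of k] k split[of k] by (cases "b \<le> k") auto
        have "psum k (psi_exp w g) = a" using psum_psi_exp_ge[of g k w] bk g by simp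
        then show ?thesis using split[of k] bk k psum_le_wdeg[of k w m] by simp
      qed
      then show "g \<in> ?D" using g gI by (simp add: diagram_monomials_def)
    qed
    show "?D \<subseteq> ?G"
    proof
      fix u assume "u \<in> ?D"
      then have u: "u \<in> monomials n" "max_index u = b" "wdeg w u = a" "a < wdeg w m + w b"
        "\<And>k. k < b \<Longrightarrow> psum k (psi_exp w m) \<le> psum k (psi_exp w u)"
        by (auto simp: diagram_monomials_def)
      \<comment> \<open>From b on the sum of u is its full degree a, which is at least the degree of
        m.\<close>
      have "psum k (psi_exp w m) \<le> psum k (psi_exp w u)" for k
      proof (cases "k < b")
        case False
        then have "psum k (psi_exp w u) = a" using psum_psi_exp_ge[of u k w] u by simp
        then show ?thesis using d psum_le_wdeg[of k w m] by simp
      qed (rule u(5))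
      then have uI: "monom_poly u \<in> ?I" unfolding I using u(1) by blast
      have "s = u" if s: "monom_poly s \<in> ?I" "u = s + c" for s c
      proof (rule ccontr)
        assume "s \<noteq> u"
        then have "c \<noteq> 0" using s by auto
        \<comment> \<open>A variable of the cofactor has index at most b, hence weight at least
          \<open>w b\<close>. Then s has degree at most \<open>a - w b\<close>, below that of m,
          contradicting domination at n.\<close>
        then obtain i where i: "i \<in> Poly_Mapping.keys c" using keys_eq_empty[of c] by blast
        then have "i \<in> Poly_Mapping.keys u" by (simp add: s(2) in_keys_iff lookup_add)
        then have "i \<le> b" "1 \<le> i" using keys_le_max_index[of i u] u(1,2) by (auto simp: monomials_def)
        then have wi: "w b \<le> w i" using w b by (simp add: weight_vector_def)
        have "w i \<le> wdeg w c"
          using varm_divides[OF i] wdeg_add[of w "c - varm i" "varm i"] by (simp add: wdeg_varm)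
        moreover have "a = wdeg w s + wdeg w c" using u(3) s(2) by (simp add: wdeg_add)
        moreover have "wdeg w m \<le> wdeg w s"
        proof -
          have "wdeg w m = psum n (psi_exp w m)" using m by (intro wdeg_psum) (auto simp: monomials_def)
          also have "\<dots> \<le> psum n (psi_exp w s)" using s(1) unfolding I by blast
          also have "\<dots> \<le> wdeg w s" by (rule psum_le_wdeg)
          finally show ?thesis .
        qed
        ultimately show False using u(4) wi by simp
      qed
      then show "u \<in> ?G" using uI u(2,3) by (auto simp: gens)
    qed
  qed
qed


section \<open>The recursion of the diagram\<close>

text \<open>The entries below b form an initial segment; position e, counted from 0, lies beyond it
  exactly when its length is at most e.\<close>

lemma sorted_nth_ge_iff:
  fixes xs :: "nat list"
  assumes "sorted xs" "e < length xs"
  shows "b \<le> xs ! e \<longleftrightarrow> length (filter (\<lambda>x. x < b) xs) \<le> e"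
  using assms
proof (induction xs arbitrary: e)
  case (Cons x xs)
  show ?case
  proof (cases "x < b")
    case True
    then show ?thesis using Cons by (cases e) auto
  next
    case False
    then have "filter (\<lambda>x. x < b) (x # xs) = []" using Cons.prems(1) by (auto simp: filter_empty_conv)
    moreover have "x \<le> (x # xs) ! e" using Cons.prems by (cases e) auto
    ultimately show ?thesis using False by simp
  qed
qed simp

lemma psum_sum_varm: "psum k (\<Sum>i\<leftarrow>xs. varm i) = length (filter (\<lambda>i. i \<le> k) xs)"
  by (induction xs) (auto simp: psum_add psum_varm)

lemma keys_sum_varm: "Poly_Mapping.keys (\<Sum>i\<leftarrow>xs. varm i) = set xs"
proof (induction xs)
  case (Cons x xs)
  then show ?case using keys_add_varm[of "\<Sum>i\<leftarrow>xs. varm i" x] by (simp add: add.commute)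
qed simp

lemma psum_mono_word: "psum k t = length (filter (\<lambda>i. i \<le> k) (mono_word t))"
  by (metis psum_sum_varm sum_mono_word)

text \<open>The word is sorted, so the maximum of its prefix of length \<open>Suc e\<close> is the
  last letter, at zero-based position e.\<close>

lemma max_index_trunc:
  assumes "e < length (mono_word t)"
  shows "max_index (trunc (Suc e) t) = mono_word t ! e"
proof -
  let ?xs = "take (Suc e) (mono_word t)"
  have keys: "Poly_Mapping.keys (trunc (Suc e) t) = set ?xs"
    unfolding trunc_def by (rule keys_sum_varm)
  have mem: "mono_word t ! e \<in> set ?xs" using assms by (auto simp: in_set_conv_nth intro!: exI[of _ e])
  have "trunc (Suc e) t \<noteq> 0" using keys mem by (metis keys_zero empty_iff)
  moreover have "Max (set ?xs) = mono_word t ! e"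
  proof (rule Max_eqI)
    fix y assume "y \<in> set ?xs"
    then obtain i where "i < Suc e" "i < length (mono_word t)" "y = mono_word t ! i"
      by (auto simp: in_set_conv_nth)
    then show "y \<le> mono_word t ! e"
      using sorted_nth_mono[OF sorted_mono_word[of t], of i e] assms by simp
  qed (use mem in auto)
  ultimately show ?thesis by (simp add: max_index_def keys)
qed

lemma length_mono_word_psi_exp: "length (mono_word (psi_exp w t)) = wdeg w t"
proof -
  obtain l where l: "Poly_Mapping.keys t \<subseteq> {..l}"
    using finite_nat_set_iff_bounded_le[of "Poly_Mapping.keys t"] by auto
  have "Poly_Mapping.keys (psi_exp w t) = set (mono_word (psi_exp w t))"
    by (metis keys_sum_varm sum_mono_word)
  moreover have "Poly_Mapping.keys (psi_exp w t) \<subseteq> {..l}"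
    using l in_keys_iff[of _ t] by (fastforce simp: in_keys_iff[of _ "psi_exp w t"] lookup_psi_exp)
  ultimately have "filter (\<lambda>i. i \<le> l) (mono_word (psi_exp w t)) = mono_word (psi_exp w t)"
    by (intro filter_True) auto
  then show ?thesis using psum_mono_word[of l "psi_exp w t"] wdeg_psum[OF l, of w] by simp
qed

text \<open>The maximum is the letter at position e, and the letters below b number
  \<open>psum (b - 1)\<close>. This turns the truncation condition of the diagram into a bound on a
  partial sum of m.\<close>

lemma le_max_index_trunc_iff:
  assumes "e < wdeg w t" "1 \<le> b"
  shows "b \<le> max_index (trunc (e + 1) (psi_exp w t)) \<longleftrightarrow> psum (b - 1) (psi_exp w t) \<le> e"
proof -
  have "(\<lambda>i. i \<le> b - 1) = (\<lambda>i. i < b)" using assms(2) by auto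
  then show ?thesis
    using assms sorted_nth_ge_iff[OF sorted_mono_word, of e "psi_exp w t" b]
    by (simp add: max_index_trunc length_mono_word_psi_exp psum_mono_word)
qed

section \<open>Stripping the last variable and counting\<close>

lemma wdeg_pos:
  assumes w: "weight_vector n w" and t: "t \<in> monomials n" "t \<noteq> 0"
  shows "0 < wdeg w t"
proof -
  have i: "max_index t \<in> Poly_Mapping.keys t" using t(2) by (rule max_index_in_keys)
  then have "0 < w (max_index t)" using w t(1) by (auto simp: weight_vector_def monomials_def)
  moreover have "wdeg w t = wdeg w (t - varm (max_index t)) + w (max_index t)"
    using varm_divides[OF i] wdeg_add[of w "t - varm (max_index t)" "varm (max_index t)"]
    by (simp add: wdeg_varm)
  ultimately show ?thesis by simp
qed

text \<open>Only the monomial 1 has degree 0, and its last index is 1 by convention. Domination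
  below 1 concerns index 0 alone, where the sum of m vanishes.\<close>

lemma diagram_monomials_zero:
  assumes w: "weight_vector n w" and m: "m \<in> monomials n" and b: "1 \<le> b" "b \<le> n"
  shows "diagram_monomials n w m 0 b = (if b = 1 then {0} else {})"
proof -
  have "u = 0" if "u \<in> diagram_monomials n w m 0 b" for u
    using that wdeg_pos[OF w, of u] by (auto simp: diagram_monomials_def)
  moreover have "0 \<in> diagram_monomials n w m 0 b \<longleftrightarrow> b = 1"
    using w b psum_0_monomials[OF psi_exp_monomials[OF m]]
    by (auto simp: diagram_monomials_def max_index_def wdeg_def weight_vector_def)
  ultimately show ?thesis by auto
qed

text \<open>Multiplying by the variable of index b leaves the partial sums below b unchanged, so
  domination below b passes between a monomial and its quotient.\<close>

lemma diagram_monomials_step: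
  assumes w: "weight_vector n w" and m: "m \<in> monomials n" and b: "1 \<le> b" "b \<le> n" and a: "0 < a"
  shows "diagram_monomials n w m a b =
    (if w b \<le> a \<and> a - w b < wdeg w m \<and> psum (b - 1) (psi_exp w m) \<le> a - w b
     then (\<lambda>u. u + varm b) ` (\<Union>k\<in>{1..b}. diagram_monomials n w m (a - w b) k) else {})"
    (is "?D = (if ?c then ?E else {})")
proof -
  have split: "psum k (psi_exp w (s + varm b)) = psum k (psi_exp w s) + (if b \<le> k then w b else 0)" for k s
    by (simp add: psi_exp_add psum_add psi_exp_varm psum_single)
  have down: "?c \<and> u \<in> ?E" if "u \<in> ?D" for u
  proof -
    have u: "u \<in> monomials n" "max_index u = b" "wdeg w u = a" "a < wdeg w m + w b"
      "\<And>k. k < b \<Longrightarrow> psum k (psi_exp w m) \<le> psum k (psi_exp w u)"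
      using that by (auto simp: diagram_monomials_def)
    have "u \<noteq> 0" using u(3) a by (auto simp: wdeg_def)
    define s where "s = u - varm b"
    have us: "u = s + varm b"
      using varm_divides[of b u] max_index_in_keys[OF \<open>u \<noteq> 0\<close>] u(2) by (simp add: s_def)
    have sn: "s \<in> monomials n" using u(1) us by (simp add: monomials_add)
    have ds: "a = wdeg w s + w b" using u(3) us by (simp add: wdeg_add wdeg_varm)
    \<comment> \<open>Domination at \<open>b - 1\<close> is inherited by s, whose partial sums are
      bounded by its degree \<open>a - w b\<close>; this is the truncation condition.\<close>
    have "psum (b - 1) (psi_exp w m) \<le> psum (b - 1) (psi_exp w s)"
      using u(5)[of "b - 1"] b split[of "b - 1" s] us by (auto split: if_splits)
    also have "\<dots> \<le> a - w b" using psum_le_wdeg[of "b - 1" w s] ds by simp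
    finally have c: ?c using u(4) ds by simp
    have k: "1 \<le> max_index s" using sn by (rule max_index_ge_1)
    have kb: "max_index s \<le> b"
    proof (cases "s = 0")
      case False
      then have "max_index s \<in> Poly_Mapping.keys u"
        using max_index_in_keys[of s] by (simp add: us keys_add_varm)
      then show ?thesis using keys_le_max_index[of _ u] u(2) by blast
    qed (use b in \<open>simp add: max_index_def\<close>)
    \<comment> \<open>The degree bound for s follows from \<open>a - w b\<close> being less than the
      degree of m, whatever the weight at its last index.\<close>
    have "s \<in> diagram_monomials n w m (a - w b) (max_index s)"
      using sn ds c u(5) kb split us by (auto simp: diagram_monomials_def)
    then have "s \<in> (\<Union>k\<in>{1..b}. diagram_monomials n w m (a - w b) k)" using k kb by auto
    then show ?thesis unfolding us using c by blast
  qed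
  moreover have "s + varm b \<in> ?D"
    if c: ?c and k: "k \<in> {1..b}" and s: "s \<in> diagram_monomials n w m (a - w b) k" for s k
  proof -
    have s: "s \<in> monomials n" "max_index s = k" "wdeg w s = a - w b"
      "\<And>l. l < k \<Longrightarrow> psum l (psi_exp w m) \<le> psum l (psi_exp w s)"
      using s by (auto simp: diagram_monomials_def)
    \<comment> \<open>For l from k to \<open>b - 1\<close>, s has already reached its full degree
      \<open>a - w b\<close>, which the truncation condition places above the sum of m at
      \<open>b - 1\<close> and so at l.\<close>
    have "psum l (psi_exp w m) \<le> psum l (psi_exp w s)" if l: "l < b" for l
    proof (cases "l < k")
      case False
      then have "psum l (psi_exp w s) = a - w b" using psum_psi_exp_ge[of s l w] s by simp
      then show ?thesis using psum_mono[of l "b - 1" "psi_exp w m"] c l by linarith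
    qed (rule s(4))
    then show ?thesis
      using s c k b max_index_add_varm[of s b]
      by (auto simp: diagram_monomials_def monomials_add varm_monomials wdeg_add wdeg_varm split)
  qed
  ultimately show ?thesis by auto
qed

text \<open>Positive weights make the recursion descend in degree. The sets for different k are
  disjoint because their last indices differ, and multiplication by a variable is injective, so
  cardinalities add up as in the diagram. Finiteness is carried along for the count of the
  union.\<close>

lemma card_diagram_monomials:
  assumes w: "weight_vector n w" and m: "m \<in> monomials n" and "1 \<le> b" "b \<le> n"
  shows "finite (diagram_monomials n w m a b) \<and> card (diagram_monomials n w m a b) = catalan w m a b"
  using assms(3-)
proof (induction a arbitrary: b rule: less_induct)
  case (less a)
  note b = less.prems
  have wb: "0 < w b" using w b by (simp add: weight_vector_def)
  show ?case
  proof (cases "a = 0")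
    case True
    \<comment> \<open>At degree 0 the condition \<open>w b \<le> a\<close> fails, so only the
      initial value remains.\<close>
    moreover have "catalan w m 0 b = (if b = 1 then 1 else 0)"
      using wb by (subst catalan.simps) auto
    ultimately show ?thesis using diagram_monomials_zero[OF w m b] by simp
  next
    case False
    let ?c = "w b \<le> a \<and> a - w b < wdeg w m \<and> psum (b - 1) (psi_exp w m) \<le> a - w b"
    let ?D = "\<lambda>k. diagram_monomials n w m (a - w b) k"
    have cat: "catalan w m a b = (if ?c then \<Sum>k=1..b. catalan w m (a - w b) k else 0)"
      using False wb le_max_index_trunc_iff[of "a - w b" w m b] b
      by (subst catalan.simps) auto
    have D: "diagram_monomials n w m a b = (if ?c then (\<lambda>u. u + varm b) ` (\<Union>k\<in>{1..b}. ?D k) else {})"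
      using False by (intro diagram_monomials_step[OF w m b]) simp
    have IH: "finite (?D k)" "card (?D k) = catalan w m (a - w b) k" if "k \<in> {1..b}" for k
      using less.IH[of "a - w b" k] that False wb b by auto
    have "card (\<Union>k\<in>{1..b}. ?D k) = (\<Sum>k=1..b. card (?D k))"
      using IH(1) by (intro card_UN_disjoint) (auto simp: diagram_monomials_def)
    also have "\<dots> = (\<Sum>k=1..b. catalan w m (a - w b) k)" using IH(2) by (intro sum.cong) auto
    finally have "card ((\<lambda>u. u + varm b) ` (\<Union>k\<in>{1..b}. ?D k)) = (\<Sum>k=1..b. catalan w m (a - w b) k)"
      by (subst card_image) (auto simp: inj_on_def)
    then show ?thesis using IH(1) by (simp add: D cat)
  qed
qed

theorem theorem10:
  fixes n :: nat and w :: "nat \<Rightarrow> nat" and m :: monomial and a b :: nat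
  assumes "weight_vector n w"
    and "m \<in> monomials n"
    and "wdeg w m \<le> a" and "a \<le> wdeg w m + Max (w ` {1..n}) - 1"
    and "1 \<le> b" and "b \<le> n"
  shows "catalan w m a b = qcount n w b a (weighted_closure n w m :: 'k::field mpoly set)"
  \<comment> \<open>From the degree of m upwards, the monomials counted by the diagram are exactly
    the minimal generators with the given degree and last index.\<close>
  using card_diagram_monomials[OF assms(1,2,5,6), of a]
    min_gens_weighted_closure[OF assms(1,2,3,5,6), where ?'k = 'k]
  by (simp add: qcount_def)

end
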